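(* Let $j>1$ be an integer. The longest prefix of the Fibonacci word that is an abelian repetition of period $F_j$ has length $$\mathit{lp}(F_j)=\begin{cases}F_j(F_{j+1}+F_{j-1}+1)-2 & \text{if } j \text{ is even},\\ F_j(F_{j+1}+F_{j-1})-2 & \text{if } j\text{ is odd}.\end{cases}$$
   Context: Fibonacci numbers: $F_0=1$, $F_1=1$, $F_{j+1}=F_j+F_{j-1}$ for $j\geq1$. The (infinite) Fibonacci word $f=abaababaabaab\cdots$ is the limit of the finite words $f_0=b$, $f_1=a$, $f_j=f_{j-1}f_{j-2}$ for $j>1$ (equivalently, the Sturmian word of angle and initial point $\phi-1$, $\phi=(1+\sqrt5)/2$). The Parikh vector $\mathcal P$ of a word over $\{a,b\}$ is the pair (number of $a$'s, number of $b$'s), with norm $|\mathcal P|$ the sum of its components; $\mathcal P$ is contained in $\mathcal Q$ if $|\mathcal P|<|\mathcal Q|$ and $\mathcal P\leq\mathcal Q$ componentwise. A word $w$ is an abelian repetition of period $m$ if $w=u_0u_1\cdots u_{j-1}u_j$ for some $j\geq3$, where $u_1,\dots,u_{j-1}$ all have length $m$ and the same Parikh vector $\mathcal P$, and the Parikh vectors of $u_0$ and $u_j$ (possibly empty words) are contained in $\mathcal P$. *)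

theory Defs
  imports Main "HOL-Number_Theory.Fib"
begin

text \<open>
  The Fibonacci numbers are indexed here from \<open>F 0 = F 1 = 1\<close>, one off from the library
  function \<^const>\<open>fib\<close>, for which \<open>fib 0 = 0\<close>.
\<close>

definition F :: "nat \<Rightarrow> nat" where
  "F j = fib (Suc j)"

lemma F_simps [simp]: "F 0 = 1" "F (Suc 0) = 1" "F (Suc (Suc j)) = F (Suc j) + F j"
  by (simp_all add: F_def)

datatype letter = a | b

fun fib_word :: "nat \<Rightarrow> letter list" where
  "fib_word 0 = [b]"
| "fib_word (Suc 0) = [a]"
| "fib_word (Suc (Suc j)) = fib_word (Suc j) @ fib_word j"

text \<open>
  The infinite Fibonacci word is the letterwise limit of the finite words: its letter at
  position \<open>i\<close> (counted from 0) is the one that all but finitely many of the finite words have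
  at position \<open>i\<close>.  The lemma \<open>fibonacci_word_nth\<close> below shows that this limit exists and that
  every \<open>fib_word j\<close> with \<open>j \<ge> 1\<close> is a prefix of it.
\<close>

definition fibonacci_word :: "nat \<Rightarrow> letter" where
  "fibonacci_word i =
     (THE c. \<exists>J. \<forall>j\<ge>J. i < length (fib_word j) \<and> fib_word j ! i = c)"

definition fibonacci_prefix :: "nat \<Rightarrow> letter list" where
  "fibonacci_prefix n = map fibonacci_word [0..<n]"

definition parikh :: "letter list \<Rightarrow> nat \<times> nat" where
  "parikh w = (count_list w a, count_list w b)"

definition parikh_norm :: "nat \<times> nat \<Rightarrow> nat" where
  "parikh_norm P = fst P + snd P"

definition parikh_contained :: "nat \<times> nat \<Rightarrow> nat \<times> nat \<Rightarrow> bool" where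
  "parikh_contained P Q \<longleftrightarrow>
     parikh_norm P < parikh_norm Q \<and> fst P \<le> fst Q \<and> snd P \<le> snd Q"

text \<open>The list \<open>us\<close> is the factorization \<open>u\<^sub>0, u\<^sub>1, \<dots>, u\<^sub>k\<close>, so it has \<open>k + 1\<close> entries.\<close>

definition abelian_repetition :: "nat \<Rightarrow> letter list \<Rightarrow> bool" where
  "abelian_repetition m w \<longleftrightarrow>
     (\<exists>k us P. k \<ge> 3 \<and> length us = k + 1 \<and> w = concat us \<and>
        (\<forall>i\<in>{1..k - 1}. length (us ! i) = m \<and> parikh (us ! i) = P) \<and>
        parikh_contained (parikh (us ! 0)) P \<and>
        parikh_contained (parikh (us ! k)) P)"

text \<open>
  A relation rather than a function: \<open>longest_prefix_length m l\<close> asserts that a longest prefix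
  of the Fibonacci word that is an abelian repetition of period \<open>m\<close> exists and has length \<open>l\<close>.
\<close>

definition longest_prefix_length :: "nat \<Rightarrow> nat \<Rightarrow> bool" where
  "longest_prefix_length m l \<longleftrightarrow>
     abelian_repetition m (fibonacci_prefix l) \<and>
     (\<forall>n. abelian_repetition m (fibonacci_prefix n) \<longrightarrow> n \<le> l)"

lemma length_fib_word: "length (fib_word j) = F j"
  by (induction j rule: fib_word.induct) simp_all

lemma fib_word_nth_stable:
  assumes "1 \<le> j" "j \<le> k" "i < length (fib_word j)"
  shows "i < length (fib_word k) \<and> fib_word k ! i = fib_word j ! i"
  using assms(2)
proof (induction k rule: dec_induct)
  case base
  then show ?case using assms(3) by simp
next
  case (step k)
  with assms(1) obtain k' where "k = Suc k'" by (cases k) auto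
  with step.IH show ?case by (simp add: nth_append)
qed

lemma le_F: "j \<le> F j"
proof (induction j rule: fib_word.induct)
  case (3 j)
  have "F j \<ge> 1" by (simp add: F_def fib_neq_0_nat Suc_leI)
  with 3 show ?case by simp
qed simp_all

lemma fibonacci_word_nth:
  assumes "1 \<le> j" "i < length (fib_word j)"
  shows "fibonacci_word i = fib_word j ! i"
  unfolding fibonacci_word_def
proof (rule the_equality)
  show "\<exists>J. \<forall>k\<ge>J. i < length (fib_word k) \<and> fib_word k ! i = fib_word j ! i"
    using fib_word_nth_stable[OF assms(1) _ assms(2)] by blast
next
  fix c assume "\<exists>J. \<forall>k\<ge>J. i < length (fib_word k) \<and> fib_word k ! i = c"
  then obtain J where "\<forall>k\<ge>J. fib_word k ! i = c" by blast
  then have "fib_word (max J j) ! i = c" by simp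
  moreover have "fib_word (max J j) ! i = fib_word j ! i"
    using fib_word_nth_stable[OF assms(1) _ assms(2), of "max J j"] by simp
  ultimately show "c = fib_word j ! i" by simp
qed

lemma fibonacci_prefix_eq_take:
  assumes "1 \<le> j" "n \<le> length (fib_word j)"
  shows "fibonacci_prefix n = take n (fib_word j)"
  using assms by (auto simp: fibonacci_prefix_def fibonacci_word_nth intro!: nth_equalityI)

end

theory Submission
  imports Defs Complex_Main
begin

text \<open>
  Let \<open>\<alpha> = 1/\<phi>\<close>.  The prefix of length \<open>n\<close> of the Fibonacci word contains
  \<open>\<lfloor>(n + 1) \<alpha>\<rfloor>\<close> letters \<open>a\<close>, and \<open>F\<^sub>j \<alpha>\<close> differs from the integer \<open>F\<^bsub>j-1\<^esub>\<close> by
  \<open>(-1)\<^sup>j \<beta>\<close> with \<open>\<beta> = \<alpha>\<^bsup>j+1\<^esup>\<close>.  Hence consecutive blocks of length \<open>F\<^sub>j\<close>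
  starting at position \<open>p\<close> have equal Parikh vectors as long as the point \<open>(p + 1) \<alpha>\<close>, moved by
  \<open>(-1)\<^sup>j \<beta>\<close> for each block, does not pass an integer.  For \<open>p < F\<^sub>j\<close> that point has distance at least
  \<open>\<beta>\<close> from every integer, with equality in the favourable direction for \<open>p = F\<^sub>j - 1\<close>, so there are at most
  \<open>T - 1\<close> blocks, where \<open>T = \<lfloor>1/\<beta>\<rfloor> = \<lfloor>\<phi>\<^bsup>j+1\<^esup>\<rfloor>\<close>.  The best head and tail have
  length \<open>F\<^sub>j - 1\<close>, which gives the length \<open>(T + 1) F\<^sub>j - 2\<close>; and \<open>T\<close> is the Lucas number
  \<open>F\<^bsub>j+1\<^esub> + F\<^bsub>j-1\<^esub>\<close>, lowered by \<open>1\<close> if \<open>j\<close> is odd.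
\<close>

section \<open>Approximation of the golden section by Fibonacci fractions\<close>

definition golden_section :: real ("\<alpha>") where
  "\<alpha> = (sqrt 5 - 1) / 2"

lemma golden_section_sq: "\<alpha> * \<alpha> = 1 - \<alpha>"
  unfolding golden_section_def by (simp add: field_simps)

lemma golden_section_bounds: "1 / 2 < \<alpha>" "\<alpha> < 2 / 3"
proof -
  have "2 < sqrt 5" by (rule real_less_rsqrt) simp
  then show "1 / 2 < \<alpha>" by (simp add: golden_section_def)
  have "sqrt 5 < 7 / 3" by (rule real_less_lsqrt) (simp_all add: power2_eq_square)
  then show "\<alpha> < 2 / 3" by (simp add: golden_section_def)
qed

lemma golden_section_pos: "0 < \<alpha>"
  using golden_section_bounds by simp

lemma fib_times_golden_section:
  "real (fib (Suc n)) * \<alpha> - real (fib n) = (-1) ^ n * \<alpha> ^ Suc n"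
proof (induction n)
  case (Suc n)
  have "real (fib (Suc (Suc n))) * \<alpha> - real (fib (Suc n))
      = - (real (fib (Suc n)) * (1 - \<alpha>) - real (fib n) * \<alpha>)"
    by (simp add: algebra_simps)
  also have "\<dots> = - (\<alpha> * (real (fib (Suc n)) * \<alpha> - real (fib n)))"
    unfolding golden_section_sq[symmetric] by (simp add: algebra_simps)
  finally show ?case using Suc.IH by simp
qed simp

text \<open>The coefficient matrix has determinant 1 or -1, so it is invertible over the integers;
  each induction step is a unimodular change of the coordinates \<open>x\<close>,
  \<open>y\<close>.\<close>

lemma int_pair_fib_basis:
  "\<exists>x y :: int. N = x * int (fib (Suc n)) + y * int (fib (Suc (Suc n)))
     \<and> M = x * int (fib n) + y * int (fib (Suc n))"
proof (induction n)
  case 0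
  have "N = (N - M) * int (fib (Suc 0)) + M * int (fib (Suc (Suc 0)))
      \<and> M = (N - M) * int (fib 0) + M * int (fib (Suc 0))" by simp
  then show ?case by blast
next
  case (Suc n)
  then obtain x y :: int where
    "N = x * int (fib (Suc n)) + y * int (fib (Suc (Suc n)))"
    "M = x * int (fib n) + y * int (fib (Suc n))" by blast
  then have "N = (y - x) * int (fib (Suc (Suc n))) + x * int (fib (Suc (Suc (Suc n))))
      \<and> M = (y - x) * int (fib (Suc n)) + x * int (fib (Suc (Suc n)))"
    by (simp add: algebra_simps)
  then show ?case by blast
qed

text \<open>In the coordinates of \<open>int_pair_fib_basis\<close> the error is
  \<open>\<alpha> ^ Suc n\<close> times \<open>\<bar>x - y * \<alpha>\<bar>\<close>. The range of
  \<open>N\<close> rules out \<open>x = 0\<close> and forces \<open>x\<close> and \<open>y\<close>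
  to have opposite signs (\<open>y\<close> may vanish), so nothing cancels and the second factor is
  at least 1.\<close>

lemma golden_section_best_approximation:
  fixes N M :: int
  assumes "0 < N" "N < int (fib (Suc (Suc n)))"
  shows "\<alpha> ^ Suc n \<le> \<bar>of_int N * \<alpha> - of_int M\<bar>"
proof -
  let ?f = "int (fib (Suc n))" and ?g = "int (fib (Suc (Suc n)))"
  obtain x y where N: "N = x * ?f + y * ?g"
    and M: "M = x * int (fib n) + y * ?f"
    using int_pair_fib_basis by blast
  have pos: "0 < ?f" "0 < ?g" by (simp_all add: fib_neq_0_nat del: fib.simps)
  have "of_int N * \<alpha> - of_int M
      = of_int x * (real (fib (Suc n)) * \<alpha> - real (fib n))
        + of_int y * (real (fib (Suc (Suc n))) * \<alpha> - real (fib (Suc n)))"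
    unfolding N M by (simp add: algebra_simps del: fib.simps)
  also have "\<dots> = (-1) ^ n * \<alpha> ^ Suc n * (of_int x - of_int y * \<alpha>)"
    unfolding fib_times_golden_section by (simp add: algebra_simps)
  finally have eq: "\<bar>of_int N * \<alpha> - of_int M\<bar> = \<alpha> ^ Suc n * \<bar>of_int x - of_int y * \<alpha>\<bar>"
    using golden_section_pos by (simp add: abs_mult power_abs)
  have "1 \<le> \<bar>of_int x - of_int y * \<alpha>\<bar>"
  proof (cases "0 < x")
    case True
    have "y \<le> 0"
    proof (rule ccontr)
      assume "\<not> y \<le> 0"
      then have "1 * ?g \<le> y * ?g" "0 \<le> x * ?f"
        using True pos by (intro mult_right_mono mult_nonneg_nonneg; simp)+
      then show False using N assms by linarith
    qed
    then have "of_int y * \<alpha> \<le> 0"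
      using golden_section_pos by (simp add: mult_nonpos_nonneg)
    moreover have "(1::real) \<le> of_int x" using True by simp
    ultimately show ?thesis by linarith
  next
    case False
    have "x \<noteq> 0"
    proof
      assume "x = 0"
      then have *: "0 < y * ?g" "y * ?g < 1 * ?g" using N assms by simp_all
      then have "0 < y" "y < 1"
        using pos by (simp_all add: zero_less_mult_iff mult_less_cancel_right del: fib.simps)
      then show False by simp
    qed
    with False have "x \<le> -1" by simp
    moreover have "0 \<le> y"
    proof (rule ccontr)
      assume "\<not> 0 \<le> y"
      then have "y * ?g \<le> 0" "x * ?f \<le> 0"
        using \<open>x \<le> -1\<close> pos by (intro mult_nonpos_nonneg; simp)+
      then show False using N assms by linarith
    qed
    ultimately have "0 \<le> of_int y * \<alpha>" "of_int x \<le> (-1::real)"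
      using golden_section_pos by simp_all
    then show ?thesis by linarith
  qed
  then have "\<alpha> ^ Suc n * 1 \<le> \<alpha> ^ Suc n * \<bar>of_int x - of_int y * \<alpha>\<bar>"
    using golden_section_pos by (intro mult_left_mono) simp_all
  with eq show ?thesis by simp
qed

lemma fib_cassini:
  "(real (fib (Suc n)))\<^sup>2 - real (fib (Suc n)) * real (fib n) - (real (fib n))\<^sup>2 = (-1) ^ n"
proof (induction n)
  case (Suc n)
  show ?case using Suc.IH by (simp add: power2_eq_square algebra_simps)
qed simp

text \<open>This is Binet's formula for the Lucas number of index \<open>Suc n\<close>, multiplied
  by \<open>\<alpha> ^ Suc n\<close>. It locates the Lucas number relative to the reciprocal of that
  power.\<close>

lemma lucas_times_golden_section_power:
  "(real (fib (Suc (Suc n))) + real (fib n)) * \<alpha> ^ Suc n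
     = 1 - (-1) ^ n * (\<alpha> ^ Suc n)\<^sup>2"
proof -
  let ?f = "real (fib (Suc n))" and ?g = "real (fib n)" and ?s = "(-1) ^ n :: real"
  have s: "?s * ?s = 1" by (simp flip: power_mult_distrib)
  have pow: "\<alpha> ^ Suc n = ?s * (?f * \<alpha> - ?g)"
    unfolding fib_times_golden_section mult.assoc[symmetric] s by simp
  have "(?f + ?g + ?g) * (?f * \<alpha> - ?g) + (?f * \<alpha> - ?g) * (?f * \<alpha> - ?g)
      = ?f * ?f * (\<alpha> * \<alpha> + \<alpha>) - ?f * ?g - ?g * ?g"
    by (simp add: algebra_simps)
  also have "\<dots> = ?s"
    unfolding fib_cassini[symmetric] golden_section_sq by (simp add: power2_eq_square)
  finally have *: "(?f + ?g + ?g) * (?f * \<alpha> - ?g) = ?s - (?f * \<alpha> - ?g) * (?f * \<alpha> - ?g)"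
    by simp
  have "(real (fib (Suc (Suc n))) + ?g) * \<alpha> ^ Suc n
      = ?s * ((?f + ?g + ?g) * (?f * \<alpha> - ?g))"
    unfolding pow by simp
  also have "\<dots> = 1 - ?s * ((?f * \<alpha> - ?g) * (?f * \<alpha> - ?g))"
    unfolding * by (simp add: right_diff_distrib s)
  also have "(?f * \<alpha> - ?g) * (?f * \<alpha> - ?g) = (?s * ?s) * ((?f * \<alpha> - ?g) * (?f * \<alpha> - ?g))"
    by (simp add: s)
  also have "\<dots> = (\<alpha> ^ Suc n)\<^sup>2"
    unfolding pow by (simp add: power2_eq_square)
  finally show ?thesis .
qed

section \<open>Letter counts of Fibonacci prefixes\<close>

lemma floor_add_eq:
  fixes x e d :: real
  assumes "\<And>M :: int. d \<le> \<bar>x - of_int M\<bar>" and "\<bar>e\<bar> < d"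
  shows "\<lfloor>x + e\<rfloor> = \<lfloor>x\<rfloor>"
proof (rule floor_unique)
  show "of_int \<lfloor>x\<rfloor> \<le> x + e"
    using assms(1)[of "\<lfloor>x\<rfloor>"] assms(2) of_int_floor_le[of x] by linarith
  show "x + e < of_int \<lfloor>x\<rfloor> + 1"
    using assms(1)[of "\<lfloor>x\<rfloor> + 1"] assms(2) real_of_int_floor_add_one_gt[of x]
    by (simp; linarith)
qed

lemma count_list_fib_word: "count_list (fib_word (Suc n)) a = fib (Suc n)"
  by (induction n rule: fib.induct) simp_all

text \<open>A position beyond the first factor of the recursion is pulled back by a Fibonacci
  number. This moves the point by an integer plus an error one power of \<open>\<alpha>\<close>
  smaller than the distance to the integers that best approximation guarantees, so the floor changes
  by that integer only.\<close>

lemma count_list_take_fib_word: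
  assumes "n < fib (Suc (Suc i))"
  shows "int (count_list (take n (fib_word (Suc i))) a) = \<lfloor>real (Suc n) * \<alpha>\<rfloor>"
  using assms
proof (induction i arbitrary: n rule: fib.induct)
  case 1
  then have "n = 0" by simp
  moreover have "\<lfloor>\<alpha>\<rfloor> = 0"
    using golden_section_bounds by (intro floor_unique) simp_all
  ultimately show ?case by simp
next
  case 2
  then have "n = 0 \<or> n = 1" by auto
  moreover have "\<lfloor>\<alpha>\<rfloor> = 0" "\<lfloor>2 * \<alpha>\<rfloor> = 1"
    using golden_section_bounds by (intro floor_unique; simp)+
  ultimately show ?case by auto
next
  case (3 i)
  let ?u = "fib_word (Suc (Suc i))" and ?v = "fib_word (Suc i)"
  have len: "length ?u = fib (Suc (Suc (Suc i)))" "length ?v = fib (Suc (Suc i))"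
    unfolding length_fib_word F_def by simp_all
  show ?case
  proof (cases "n < length ?u")
    case True
    then show ?thesis using "3.IH"(1)[of n] len by (simp del: fib.simps)
  next
    case False
    define n' where "n' = n - length ?u"
    have n: "n = length ?u + n'" using False by (simp add: n'_def)
    have n': "n' < fib (Suc (Suc i))"
      using "3.prems" len n by simp
    have "0 < fib (Suc i)" by (simp add: fib_neq_0_nat)
    then have "Suc n' < fib (Suc (Suc (Suc i)))" using n' by simp
    then have approx: "\<alpha> ^ Suc (Suc i) \<le> \<bar>real (Suc n') * \<alpha> - of_int M\<bar>" for M
      using golden_section_best_approximation[of "int (Suc n')" "Suc i" M]
      by (simp del: fib.simps power_Suc)
    have "\<alpha> * \<alpha> ^ Suc (Suc i) < 1 * \<alpha> ^ Suc (Suc i)"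
      using golden_section_bounds by (intro mult_strict_right_mono) simp_all
    then have small: "\<bar>(-1) ^ Suc (Suc i) * \<alpha> ^ Suc (Suc (Suc i))\<bar> < \<alpha> ^ Suc (Suc i)"
      using golden_section_pos by (simp add: abs_mult power_abs)
    have "int (count_list (take n (fib_word (Suc (Suc (Suc i))))) a)
        = int (fib (Suc (Suc i))) + \<lfloor>real (Suc n') * \<alpha>\<rfloor>"
      using "3.IH"(2)[OF n'] count_list_fib_word[of "Suc i"]
      by (simp add: n del: fib.simps)
    also have "\<lfloor>real (Suc n') * \<alpha>\<rfloor>
        = \<lfloor>real (Suc n') * \<alpha> + (-1) ^ Suc (Suc i) * \<alpha> ^ Suc (Suc (Suc i))\<rfloor>"
      by (rule floor_add_eq[OF approx small, symmetric])
    also have "\<dots> = \<lfloor>real (Suc n) * \<alpha> - real (fib (Suc (Suc i)))\<rfloor>"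
      unfolding fib_times_golden_section[symmetric] n len(1)
      by (simp add: algebra_simps del: fib.simps)
    finally show ?thesis by linarith
  qed
qed

lemma count_list_fibonacci_prefix:
  "int (count_list (fibonacci_prefix n) a) = \<lfloor>real (Suc n) * \<alpha>\<rfloor>"
proof -
  have n: "n < F (Suc n)" using le_F[of "Suc n"] by simp
  then have "fibonacci_prefix n = take n (fib_word (Suc n))"
    by (intro fibonacci_prefix_eq_take) (simp_all add: length_fib_word)
  then show ?thesis using count_list_take_fib_word[of n n] n by (simp add: F_def)
qed

section \<open>Abelian repetitions expressed through letter counts\<close>

lemma count_list_letters: "count_list w a + count_list w b = length w"
proof (induction w)
  case (Cons c w)
  then show ?case by (cases c) simp_all
qed simp

lemma parikh_norm_parikh: "parikh_norm (parikh w) = length w"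
  by (simp add: parikh_norm_def parikh_def count_list_letters)

lemma length_fibonacci_prefix [simp]: "length (fibonacci_prefix n) = n"
  by (simp add: fibonacci_prefix_def)

lemma take_fibonacci_prefix: "k \<le> n \<Longrightarrow> take k (fibonacci_prefix n) = fibonacci_prefix k"
  by (simp add: fibonacci_prefix_def take_map)

lemma concat_take_prefix: "concat (take i us) = take (length (concat (take i us))) (concat us)"
proof -
  have "concat us = concat (take i us) @ concat (drop i us)"
    by (metis append_take_drop_id concat_append)
  then show ?thesis by simp
qed

text \<open>The upper bound needs only this numerical content: counts of \<open>a\<close> at the
  block boundaries, with \<open>K = k - 1\<close> blocks. Containment of head and tail enters only
  as length less than \<open>m\<close>.\<close>

lemma abelian_repetition_fibonacci_prefixD:
  assumes "abelian_repetition m (fibonacci_prefix n)"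
  obtains p K q where "2 \<le> K" "p < m" "n < p + (K + 1) * m"
    "\<And>i. i \<le> K \<Longrightarrow>
       count_list (fibonacci_prefix (p + i * m)) a = count_list (fibonacci_prefix p) a + i * q"
proof -
  obtain k us P where k: "k \<ge> 3" and len: "length us = k + 1"
    and w: "fibonacci_prefix n = concat us"
    and blocks: "\<And>i. i \<in> {1..k - 1} \<Longrightarrow> length (us ! i) = m \<and> parikh (us ! i) = P"
    and head: "parikh_contained (parikh (us ! 0)) P"
    and tail: "parikh_contained (parikh (us ! k)) P"
    using assms unfolding abelian_repetition_def by blast
  have "1 \<in> {1..k - 1}" using k by simp
  then have "parikh_norm P = m" using blocks parikh_norm_parikh by metis
  with head tail have short: "length (us ! 0) < m" "length (us ! k) < m"
    by (simp_all add: parikh_contained_def parikh_norm_parikh)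
  define p where "p = length (us ! 0)"
  have take_Suc: "concat (take (Suc i) us) = concat (take i us) @ us ! i" if "i \<le> k" for i
    using that len by (simp add: take_Suc_conv_app_nth)
  have step: "length (concat (take (Suc i) us)) = p + i * m
      \<and> count_list (concat (take (Suc i) us)) a = count_list (us ! 0) a + i * fst P"
    if "i \<le> k - 1" for i
    using that
  proof (induction i)
    case 0
    show ?case using take_Suc[of 0] by (simp add: p_def)
  next
    case (Suc i)
    then have "length (us ! Suc i) = m" "count_list (us ! Suc i) a = fst P"
      using blocks[of "Suc i"] by (auto simp: parikh_def)
    then show ?case using Suc take_Suc[of "Suc i"] by simp
  qed
  \<comment> \<open>Initial concatenations of the factors are themselves Fibonacci prefixes, which
    turns the counts in \<open>step\<close> into prefix counts.\<close>
  have pre: "concat (take (Suc i) us) = fibonacci_prefix (p + i * m)" if "i \<le> k - 1" for i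
  proof -
    let ?l = "length (concat (take (Suc i) us))"
    have *: "concat (take (Suc i) us) = take ?l (fibonacci_prefix n)"
      unfolding w by (rule concat_take_prefix)
    then have "?l \<le> n" by (metis length_fibonacci_prefix length_take min.cobounded1)
    then show ?thesis using * step[OF that] take_fibonacci_prefix by metis
  qed
  show thesis
  proof (rule that[of "k - 1" p "fst P"])
    have "n = length (concat (take (Suc k) us))" using w len
      by (metis Suc_eq_plus1 length_fibonacci_prefix order_refl take_all)
    also have "\<dots> = length (concat (take (Suc (k - 1)) us)) + length (us ! k)"
      using take_Suc[of k] k by simp
    finally show "n < p + (k - 1 + 1) * m" using step[of "k - 1"] short by simp
    show "count_list (fibonacci_prefix (p + i * m)) a
        = count_list (fibonacci_prefix p) a + i * fst P" if "i \<le> k - 1" for i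
      using step[OF that] pre[OF that] step[of 0] pre[of 0] by simp
  qed (use k short in \<open>simp_all add: p_def\<close>)
qed

definition fibonacci_factor :: "nat \<Rightarrow> nat \<Rightarrow> letter list" where
  "fibonacci_factor s t = map fibonacci_word [s..<t]"

lemma fibonacci_factor_append:
  "r \<le> s \<Longrightarrow> s \<le> t \<Longrightarrow> fibonacci_factor r s @ fibonacci_factor s t = fibonacci_factor r t"
  unfolding fibonacci_factor_def by (metis le_Suc_ex map_append upt_add_eq_append)

lemma fibonacci_factor_0: "fibonacci_factor 0 t = fibonacci_prefix t"
  by (simp add: fibonacci_factor_def fibonacci_prefix_def)

lemma count_list_fibonacci_factor:
  "s \<le> t \<Longrightarrow> int (count_list (fibonacci_factor s t) c)
     = int (count_list (fibonacci_prefix t) c) - int (count_list (fibonacci_prefix s) c)"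
  using fibonacci_factor_append[of 0 s t, THEN arg_cong[of _ _ "\<lambda>w. int (count_list w c)"]]
  by (simp add: fibonacci_factor_0)

lemma length_fibonacci_factor [simp]: "length (fibonacci_factor s t) = t - s"
  by (simp add: fibonacci_factor_def)

lemma concat_fibonacci_factors:
  "concat (map (\<lambda>i. fibonacci_factor (p + i * m) (p + Suc i * m)) [0..<K])
     = fibonacci_factor p (p + K * m)"
  by (induction K) (simp_all add: fibonacci_factor_append, simp add: fibonacci_factor_def)

lemma parikh_eqI: "length w = n \<Longrightarrow> count_list w a = c \<Longrightarrow> parikh w = (c, n - c)"
  using count_list_letters[of w] by (simp add: parikh_def)

text \<open>Counts of \<open>a\<close> suffice, since lengths determine the counts of
  \<open>b\<close>: \<open>p - c\<close>, \<open>e - d\<close> and \<open>m - q\<close> are those of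
  head, tail and block.\<close>

lemma abelian_repetition_fibonacci_prefixI:
  assumes "2 \<le> K" "p < m" "e < m"
    and blocks: "\<And>i. i \<le> K \<Longrightarrow> int (count_list (fibonacci_prefix (p + i * m)) a)
          = int (count_list (fibonacci_prefix p) a) + int i * int q"
    and head: "count_list (fibonacci_prefix p) a = c" "c \<le> q" "p - c \<le> m - q"
    and tail: "int (count_list (fibonacci_prefix (p + K * m + e)) a)
          = int (count_list (fibonacci_prefix (p + K * m)) a) + int d" "d \<le> q" "e - d \<le> m - q"
  shows "abelian_repetition m (fibonacci_prefix (p + K * m + e))"
proof -
  define vs where "vs = map (\<lambda>i. fibonacci_factor (p + i * m) (p + Suc i * m)) [0..<K]"
  define us where
    "us = fibonacci_prefix p # vs @ [fibonacci_factor (p + K * m) (p + K * m + e)]"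
  have nth: "us ! 0 = fibonacci_prefix p"
    "us ! Suc K = fibonacci_factor (p + K * m) (p + K * m + e)"
    by (simp_all add: us_def vs_def nth_append)
  have block: "length (us ! i) = m \<and> parikh (us ! i) = (q, m - q)" if i: "i \<in> {1..K}" for i
  proof -
    obtain i' where i': "i = Suc i'" "i' < K" using i by (cases i) auto
    then have eq: "us ! i = fibonacci_factor (p + i' * m) (p + Suc i' * m)"
      by (simp add: us_def vs_def nth_append)
    have "int (count_list (us ! i) a) = int q"
      unfolding eq using blocks[of i'] blocks[of "Suc i'"] i'
      by (subst count_list_fibonacci_factor) (simp_all add: algebra_simps)
    moreover have "length (us ! i) = m" unfolding eq by simp
    ultimately show ?thesis using parikh_eqI[of "us ! i" m q] by simp
  qed
  \<comment> \<open>Together with \<open>d \<le> e\<close> and \<open>c \<le> p\<close> below, this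
    makes the natural-number subtractions exact.\<close>
  have "q \<le> m" using block[of 1] \<open>2 \<le> K\<close> count_list_letters[of "us ! 1"]
    by (simp add: parikh_def)
  have contained: "parikh_contained (c', l - c') (q, m - q)"
    if "l < m" "c' \<le> l" "c' \<le> q" "l - c' \<le> m - q" for c' l
    using that \<open>q \<le> m\<close> by (simp add: parikh_contained_def parikh_norm_def)
  have cnt: "count_list (us ! Suc K) a = d"
    unfolding nth using tail(1) count_list_fibonacci_factor[of "p + K * m" "p + K * m + e" a]
    by simp
  then have "d \<le> e" "c \<le> p"
    using count_list_letters[of "us ! Suc K"] count_list_letters[of "us ! 0"] head(1)
    by (simp_all add: nth)
  then have "parikh_contained (parikh (us ! 0)) (q, m - q)"
    "parikh_contained (parikh (us ! Suc K)) (q, m - q)"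
    using contained[of p c] contained[of e d] assms parikh_eqI[OF _ cnt, of e]
      parikh_eqI[OF _ head(1), of p]
    by (simp_all add: nth)
  moreover have "concat us = fibonacci_prefix (p + K * m + e)"
    by (simp add: us_def vs_def concat_fibonacci_factors fibonacci_factor_append
        flip: fibonacci_factor_0 del: mult_Suc)
  moreover have "length us = Suc K + 1" by (simp add: us_def vs_def)
  ultimately show ?thesis
    unfolding abelian_repetition_def using block \<open>2 \<le> K\<close>
    by (intro exI[of _ "Suc K"] exI[of _ us] exI[of _ "(q, m - q)"]) simp
qed

section \<open>Maximal number of blocks and the resulting length\<close>

theorem theorem6p3:
  fixes j :: nat
  assumes "j > 1"
  shows "longest_prefix_length (F j)
           (if even j then F j * (F (j + 1) + F (j - 1) + 1) - 2
            else F j * (F (j + 1) + F (j - 1)) - 2)"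
proof -
  define m where "m = fib (Suc j)"
  define q where "q = fib j"
  define \<beta> where "\<beta> = \<alpha> ^ Suc j"
  define s :: real where "s = (-1) ^ j"
  define L where "L = fib (Suc (Suc j)) + fib j"
  define T where "T = (if even j then L else L - 1)"
  have F: "F j = m" "F (j - 1) = q" "F (j + 1) = fib (Suc (Suc j))"
    using assms by (simp_all add: F_def m_def q_def del: fib.simps)
  have L: "L = F (j + 1) + F (j - 1)"
    using assms by (simp add: F_def L_def del: fib.simps)
  \<comment> \<open>Aims at \<open>3 \<le> T\<close>: the definition asks for at least two blocks,
    and \<open>T - 1\<close> will be used.\<close>
  then have "2 * j \<le> L"
    using le_F[of "j + 1"] le_F[of "j - 1"] assms by linarith
  moreover have "3 \<le> j" if "odd j" using that assms by (cases "j = 2") auto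
  ultimately have T3: "3 \<le> T" using assms by (cases "even j") (auto simp: T_def)
  have "0 < q" using assms by (simp add: q_def fib_neq_0_nat)
  have m_eq: "m = q + fib (j - 1)" using assms by (cases j) (simp_all add: m_def q_def)
  moreover have "0 < fib (j - 1)" using assms by (simp add: fib_neq_0_nat)
  ultimately have "q < m" by simp
  have m\<alpha>: "real m * \<alpha> = real q + s * \<beta>"
    using fib_times_golden_section[of j] by (simp add: m_def q_def s_def \<beta>_def)
  have \<beta>: "0 < \<beta>" "\<beta> \<le> 1 - \<alpha>" "\<beta> < 1 / 2"
  proof -
    show "0 < \<beta>" using golden_section_pos by (simp add: \<beta>_def)
    have "\<beta> \<le> \<alpha> ^ 2"
      unfolding \<beta>_def using assms golden_section_bounds by (intro power_decreasing) simp_all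
    then show "\<beta> \<le> 1 - \<alpha>" by (simp add: power2_eq_square golden_section_sq)
    then show "\<beta> < 1 / 2" using golden_section_bounds by simp
  qed
  \<comment> \<open>\<open>L * \<beta>\<close> misses 1 by \<open>\<beta> * \<beta>\<close>, which
    is less than one shift: from below for even \<open>j\<close>, from above for odd
    \<open>j\<close>. Hence the parity split in \<open>T\<close>.\<close>
  have "\<beta> * \<beta> < 1 * \<beta>" using \<beta> by (intro mult_strict_right_mono) simp_all
  moreover have L\<beta>: "real L * \<beta> = 1 - s * (\<beta> * \<beta>)"
    using lucas_times_golden_section_power[of j]
    by (simp add: L_def s_def \<beta>_def power2_eq_square)
  moreover have "0 < \<beta> * \<beta>" using \<beta> by simp
  moreover have "real T = (if even j then real L else real L - 1)"
    using T3 by (auto simp: T_def)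
  ultimately have T: "real T * \<beta> < 1" "1 < real T * \<beta> + \<beta>"
    by (auto simp: s_def left_diff_distrib)
  have count: "int (count_list (fibonacci_prefix n) a) = \<lfloor>real (Suc n) * \<alpha>\<rfloor>" for n
    by (rule count_list_fibonacci_prefix)
  let ?l = "(m - 1) + (T - 1) * m + (m - 1)"
  have l: "?l = (T + 1) * m - 2"
  proof -
    obtain t where "T = Suc t" using T3 by (cases T) auto
    then show ?thesis using \<open>q < m\<close> by (simp add: algebra_simps)
  qed
  also have "\<dots> = (if even j then F j * (F (j + 1) + F (j - 1) + 1) - 2
      else F j * (F (j + 1) + F (j - 1)) - 2)"
  proof -
    have "T + 1 = (if even j then L + 1 else L)" using T3 by (auto simp: T_def)
    then show ?thesis unfolding L[symmetric] F(1) by (simp add: mult.commute)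
  qed
  finally have length_eq: "?l = \<dots>" .

  have "abelian_repetition m (fibonacci_prefix ?l)"
  proof -
    \<comment> \<open>The point at boundary \<open>Suc i * m\<close> lies above the integer
      \<open>Suc i * q\<close> for even \<open>j\<close> and below it for odd \<open>j\<close>;
      \<open>c\<close> is the resulting correction of the floor.\<close>
    define c :: int where "c = (if even j then 0 else - 1)"
    have full: "int (count_list (fibonacci_prefix (m - 1 + i * m)) a) = int (Suc i) * int q + c"
      if i: "Suc i \<le> T" for i
    proof -
      have "Suc (m - 1 + i * m) = Suc i * m" using \<open>q < m\<close> by simp
      moreover have "real (Suc i * m) * \<alpha> = real (Suc i) * real q + s * (real (Suc i) * \<beta>)"
        unfolding of_nat_mult mult.assoc m\<alpha> by (simp add: algebra_simps)
      moreover have "\<lfloor>real (Suc i) * real q + s * (real (Suc i) * \<beta>)\<rfloor>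
          = int (Suc i) * int q + c"
      proof (rule floor_unique)
        have "real (Suc i) * \<beta> \<le> real T * \<beta>"
          using i \<beta> by (intro mult_right_mono) simp_all
        then have "real (Suc i) * \<beta> < 1" using T(1) by (rule le_less_trans)
        moreover have "0 < real (Suc i) * \<beta>" using \<beta> by simp
        ultimately show
          "of_int (int (Suc i) * int q + c) \<le> real (Suc i) * real q + s * (real (Suc i) * \<beta>)"
          "real (Suc i) * real q + s * (real (Suc i) * \<beta>) < of_int (int (Suc i) * int q + c) + 1"
          unfolding c_def s_def of_int_add of_int_mult of_int_of_nat_eq by auto
      qed
      ultimately show ?thesis using count by metis
    qed
    \<comment> \<open>The end is one letter short of boundary \<open>(T + 1) * m\<close>, where the
      shift already exceeds 1. Subtracting \<open>\<alpha>\<close> undoes the passage for even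
      \<open>j\<close>; for odd \<open>j\<close>, \<open>\<beta> \<le> 1 - \<alpha>\<close> prevents
      a further one. So the tail contains \<open>q + c\<close> letters \<open>a\<close>, just like
      the head.\<close>
    have last: "int (count_list (fibonacci_prefix ?l) a) = int (T + 1) * int q + 2 * c"
    proof -
      have "2 \<le> (T + 1) * m" using T3 \<open>q < m\<close> mult_le_mono[of 2 "T + 1" 1 m] by simp
      then have "Suc ?l = (T + 1) * m - 1" unfolding l by simp
      moreover have "real ((T + 1) * m - 1) = real ((T + 1) * m) - 1"
        using \<open>q < m\<close> by (subst of_nat_diff) simp_all
      moreover have "real ((T + 1) * m) * \<alpha> = real (T + 1) * real q + s * (real T * \<beta> + \<beta>)"
        unfolding of_nat_mult mult.assoc m\<alpha> by (simp add: algebra_simps)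
      ultimately have "real (Suc ?l) * \<alpha> = real (T + 1) * real q + s * (real T * \<beta> + \<beta>) - \<alpha>"
        by (simp add: left_diff_distrib)
      moreover have "\<lfloor>real (T + 1) * real q + s * (real T * \<beta> + \<beta>) - \<alpha>\<rfloor>
          = int (T + 1) * int q + 2 * c"
        using T \<beta> golden_section_bounds
        by (intro floor_unique) (auto simp: c_def s_def algebra_simps)
      ultimately show ?thesis using count by metis
    qed
    show ?thesis
    \<comment> \<open>Head and tail are each a block short of one letter: a \<open>b\<close> for
      even \<open>j\<close>, an \<open>a\<close> for odd \<open>j\<close>.\<close>
    proof (rule abelian_repetition_fibonacci_prefixI[where c = "nat (int q + c)" and q = q
          and d = "nat (int q + c)"])
      have nat_eq: "int (nat (int q + c)) = int q + c" using \<open>0 < q\<close> by (simp add: c_def)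
      have first: "int (count_list (fibonacci_prefix (m - 1)) a) = int q + c"
        using full[of 0] T3 by simp
      show "int (count_list (fibonacci_prefix (m - 1 + i * m)) a)
          = int (count_list (fibonacci_prefix (m - 1)) a) + int i * int q" if "i \<le> T - 1" for i
        using first full[of i] that T3 by (simp add: algebra_simps)
      show "count_list (fibonacci_prefix (m - 1)) a = nat (int q + c)"
        using first by linarith
      show "int (count_list (fibonacci_prefix ?l) a)
          = int (count_list (fibonacci_prefix (m - 1 + (T - 1) * m)) a) + int (nat (int q + c))"
        unfolding nat_eq using last full[of "T - 1"] T3 by (simp add: algebra_simps)
      show "nat (int q + c) \<le> q" "m - 1 - nat (int q + c) \<le> m - q"
        "nat (int q + c) \<le> q" "m - 1 - nat (int q + c) \<le> m - q"
        by (auto simp: c_def)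
    qed (use T3 \<open>q < m\<close> in simp_all)
  qed
  moreover have "n \<le> ?l" if rep: "abelian_repetition m (fibonacci_prefix n)" for n
  proof -
    obtain p K q' where K: "2 \<le> K" and p: "p < m" and n: "n < p + (K + 1) * m"
      and blocks: "\<And>i. i \<le> K \<Longrightarrow> count_list (fibonacci_prefix (p + i * m)) a
          = count_list (fibonacci_prefix p) a + i * q'"
      using abelian_repetition_fibonacci_prefixD[OF rep] by metis
    define x where "x = real (Suc p) * \<alpha>"
    define r where "r = int q' - int q"
    have floor: "\<lfloor>x + s * (real i * \<beta>)\<rfloor> = \<lfloor>x\<rfloor> + int i * r" if "i \<le> K" for i
    proof -
      have "real (Suc (p + i * m)) * \<alpha> = x + real i * (real m * \<alpha>)"
        by (simp add: x_def algebra_simps)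
      also have "\<dots> = x + s * (real i * \<beta>) + of_int (int i * int q)"
        unfolding m\<alpha> by (simp add: algebra_simps)
      finally have "\<lfloor>real (Suc (p + i * m)) * \<alpha>\<rfloor> = \<lfloor>x + s * (real i * \<beta>)\<rfloor> + int i * int q"
        by (simp only: floor_add_int)
      moreover have "int (count_list (fibonacci_prefix (p + i * m)) a)
          = int (count_list (fibonacci_prefix p) a) + int i * int q'"
        using blocks[OF that] by simp
      ultimately show ?thesis
        unfolding count x_def[symmetric] r_def by (simp add: algebra_simps)
    qed
    have s: "s = 1 \<or> s = - 1" by (cases "even j") (simp_all add: s_def)
    txt \<open>Two blocks shift the point by less than \<open>1\<close>, so they already force the blocks to
      contain \<open>q\<close> letters \<open>a\<close>.\<close>
    have "\<lfloor>x + s * (2 * \<beta>)\<rfloor> = \<lfloor>x\<rfloor> + 2 * r" using floor[OF K] by simp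
    then have "\<bar>2 * real_of_int r\<bar> < 2" using s \<beta>(1,3) by (auto simp: floor_eq_iff; linarith)
    then have "r = 0" by linarith
    then have stay: "\<lfloor>x + s * (real K * \<beta>)\<rfloor> = \<lfloor>x\<rfloor>" using floor[of K] by simp
    \<comment> \<open>\<open>Suc p\<close> can equal \<open>m\<close>, but stays below
      \<open>m + q\<close>, the next Fibonacci number, so the distance \<open>\<beta>\<close> is
      available.\<close>
    have "int (Suc p) < int (fib (Suc (Suc j)))"
      using p \<open>0 < q\<close> by (simp add: m_def q_def)
    then have dist: "\<beta> \<le> \<bar>x - of_int M\<bar>" for M
      using golden_section_best_approximation[of "int (Suc p)" j M]
      by (simp add: x_def \<beta>_def del: fib.simps power_Suc)
    \<comment> \<open>The initial gap of at least \<open>\<beta>\<close> behind the moving point and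
      its \<open>K\<close> shifts fit into one unit interval.\<close>
    have "real K * \<beta> + \<beta> \<le> 1"
      using s
    proof
      assume "s = 1"
      then show ?thesis using stay dist[of "\<lfloor>x\<rfloor>"] by (simp add: floor_eq_iff; linarith)
    next
      assume "s = - 1"
      then show ?thesis using stay dist[of "\<lfloor>x\<rfloor> + 1"] by (simp add: floor_eq_iff; linarith)
    qed
    moreover have "real T * \<beta> \<le> real K * \<beta>" if "T \<le> K"
      using that \<beta> by (intro mult_right_mono) simp_all
    ultimately have "K + 1 \<le> T" using T(2) by (cases "T \<le> K") linarith+
    then have "(K + 1) * m \<le> T * m" by (rule mult_right_mono) simp
    \<comment> \<open>The 2 comes from two strict bounds: head and tail are each shorter than
      \<open>m\<close>.\<close>
    then have "n + 2 \<le> (T + 1) * m" using n p by simp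
    then show ?thesis unfolding l by simp
  qed
  ultimately show ?thesis
    unfolding longest_prefix_length_def F(1) length_eq[symmetric, unfolded F(1)] by blast
qed

end
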